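(* Let $a,b\ge 1$, let $\rho$ be the canonical sequential form of a non-crossing partition of length $m$ for some $m\ge 1$, and let $\tau=1^a(\rho+1)1^b$. If $n\ge m+a+b-1$, then the total number of occurrences of the subword $\tau$ within all the members of $NC_n$, i.e. $\sum_{\pi\in NC_n}\mu_\tau(\pi)$, is $\binom{2r}{r+1}$, where $r=n-m-a-b+1$.
   Context: A set partition of $[n]=\{1,\dots,n\}$ with blocks $B_1,\dots,B_k$ ordered so that $\min B_1<\cdots<\min B_k$ is represented by its canonical sequential form $\pi=\pi_1\cdots\pi_n$, where $i\in B_{\pi_i}$ for each $i$; $n$ is its length. It is non-crossing if $\pi$ contains no (not necessarily consecutive) subsequence of the form $a\,b\,a\,b$ with $a<b$. $NC_n$ denotes the set of non-crossing partitions of $[n]$, identified with their canonical sequential forms. A subword pattern is a finite sequence $\tau=\tau_1\cdots\tau_k$ of positive integers whose set of distinct letters is $[\ell]$ for some $\ell$. An occurrence of $\tau$ in a sequence $\sigma_1\cdots\sigma_n$ is an index $i\in[n-k+1]$ such that the string of consecutive letters $\sigma_i\cdots\sigma_{i+k-1}$ is order-isomorphic to $\tau$ (same relative order, including equalities). $\mu_\tau(\pi)$ denotes the number of occurrences of $\tau$ in $\pi$. $\rho+1$ is the sequence obtained by adding $1$ to each entry of $\rho$, $1^a$ is the word of $a$ ones, and juxtaposition is concatenation. *)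

theory Defs
  imports Complex_Main "HOL-Library.Disjoint_Sets" "HOL-Library.Sublist"
begin

text \<open>\<open>Bs\<close> lists the blocks of \<open>P\<close> in the order of their minima. Blocks and positions are
  numbered from 1 in the mathematics, lists from 0: the letter at position \<open>i\<close> is \<open>w ! (i - 1)\<close>
  and the block with number \<open>j\<close> is \<open>Bs ! (j - 1)\<close>.\<close>

definition canonical_sequential_form :: "nat \<Rightarrow> nat set set \<Rightarrow> nat list \<Rightarrow> bool" where
  "canonical_sequential_form n P w \<longleftrightarrow>
     length w = n \<and>
     (\<exists>Bs. set Bs = P \<and> sorted_wrt (\<lambda>B C. Min B < Min C) Bs \<and>
        (\<forall>i\<in>{1..n}. w ! (i - 1) \<in> {1..length Bs} \<and> i \<in> Bs ! (w ! (i - 1) - 1)))"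

definition noncrossing :: "nat list \<Rightarrow> bool" where
  "noncrossing w \<longleftrightarrow> \<not> (\<exists>x y. x < y \<and> subseq [x, y, x, y] w)"

text \<open>A set partition is identified with its canonical sequential form, so the members of
  \<open>NC n\<close> are words.\<close>

definition NC :: "nat \<Rightarrow> nat list set" where
  "NC n = {w. (\<exists>P. partition_on {1..n} P \<and> canonical_sequential_form n P w) \<and> noncrossing w}"

definition order_isomorphic :: "nat list \<Rightarrow> nat list \<Rightarrow> bool" where
  "order_isomorphic u v \<longleftrightarrow>
     length u = length v \<and>
     (\<forall>i<length u. \<forall>j<length u.
        (u ! i < u ! j \<longleftrightarrow> v ! i < v ! j) \<and> (u ! i = u ! j \<longleftrightarrow> v ! i = v ! j))"

definition occurrences :: "nat list \<Rightarrow> nat list \<Rightarrow> nat" where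
  "occurrences \<tau> w =
     card {i. i + length \<tau> \<le> length w \<and>
              order_isomorphic (take (length \<tau>) (drop i w)) \<tau>}"

end

theory Submission
  imports Defs
begin

text \<open>Call a letter admissible for a non-crossing word if appending it keeps the word in canonical
  form and non-crossing. Appending the \<open>j\<close>-th smallest admissible letter leaves \<open>j + 1\<close>
  admissible letters, so the number of extensions of a word by \<open>n\<close> letters is a ballot number
  depending only on the number of its admissible letters. In a non-crossing word \<open>p v s\<close> the factor
  \<open>v\<close> is an occurrence of \<open>\<tau>\<close> iff \<open>v = x\<^sup>a (\<rho> + M) x\<^sup>b\<close>, where \<open>x\<close> is admissible for \<open>p\<close> and
  \<open>M\<close> is the maximum of \<open>p x\<close>; and \<open>p v\<close> has as many admissible letters as \<open>p x\<close>. Hence at each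
  of the \<open>r\<close> possible positions \<open>\<tau>\<close> occurs in as many members of \<open>NC n\<close> as \<open>NC r\<close> has elements,
  which is the Catalan number \<open>C\<close> of index \<open>r\<close>, and \<open>r C\<close> is the required binomial coefficient.\<close>

section \<open>Restricted growth words\<close>

text \<open>The usual condition that a letter exceeds the maximum of its predecessors by at most 1,
  phrased through the set of earlier letters so that the empty prefix needs no convention.\<close>

definition restricted_growth :: "nat list \<Rightarrow> bool" where
  "restricted_growth w \<longleftrightarrow> (\<forall>i<length w. 1 \<le> w ! i \<and> {1..<w ! i} \<subseteq> set (take i w))"

lemma restricted_growth_Nil [simp]: "restricted_growth []"
  by (simp add: restricted_growth_def)

lemma restricted_growth_snoc:
  "restricted_growth (w @ [x]) \<longleftrightarrow> restricted_growth w \<and> 1 \<le> x \<and> {1..<x} \<subseteq> set w"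
  unfolding restricted_growth_def by (auto simp: less_Suc_eq nth_append)

lemma restricted_growth_appendD: "restricted_growth (u @ v) \<Longrightarrow> restricted_growth u"
  by (induction v rule: rev_induct) (auto simp: restricted_growth_snoc simp flip: append_assoc)

lemma atLeastLessThan_subset_atLeastAtMost_nat:
  fixes x k :: nat
  shows "{1..<x} \<subseteq> {1..k} \<longleftrightarrow> x \<le> k + 1"
proof
  assume "{1..<x} \<subseteq> {1..k}"
  moreover have "k + 1 \<notin> {1..k}" by simp
  ultimately have "k + 1 \<notin> {1..<x}" by blast
  then show "x \<le> k + 1" by simp
qed auto

lemma set_restricted_growth: "restricted_growth w \<Longrightarrow> set w = {1..card (set w)}"
proof (induction w rule: rev_induct)
  case (snoc x w)
  then have IH: "set w = {1..card (set w)}" and x: "1 \<le> x" "{1..<x} \<subseteq> set w"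
    by (auto simp: restricted_growth_snoc)
  define k where "k = card (set w)"
  have w: "set w = {1..k}" using IH k_def by simp
  have "x \<le> k + 1"
    using x(2) unfolding w by (simp only: atLeastLessThan_subset_atLeastAtMost_nat)
  then have "set (w @ [x]) = {1..max k x}"
    using w x by auto
  then show ?case by simp
qed simp

lemma restricted_growth_snoc_card:
  assumes "restricted_growth w"
  shows "restricted_growth (w @ [x]) \<longleftrightarrow> 1 \<le> x \<and> x \<le> card (set w) + 1"
proof -
  have w: "set w = {1..card (set w)}" using set_restricted_growth[OF assms] .
  have "{1..<x} \<subseteq> set w \<longleftrightarrow> x \<le> card (set w) + 1"
    by (subst w) (rule atLeastLessThan_subset_atLeastAtMost_nat)
  then show ?thesis using assms by (simp add: restricted_growth_snoc)
qed

text \<open>At the first position where \<open>h\<close> moved a letter \<open>x\<close>, the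
  smaller of \<open>x\<close> and \<open>h x\<close> would have occurred before and so be fixed by
  \<open>h\<close>, against injectivity. This later recovers \<rho> from an occurrence of the
  pattern.\<close>

lemma restricted_growth_map_inj_eq:
  assumes "restricted_growth u" "restricted_growth (map h u)" "inj_on h (set u)"
  shows "map h u = u"
  using assms
proof (induction u rule: rev_induct)
  case (snoc x u)
  have IH: "map h u = u"
    using snoc by (auto simp: restricted_growth_snoc inj_on_def)
  have h: "h z = z" if "z \<in> set u" for z
    using IH that by (metis map_eq_conv list.map_ident)
  have a: "1 \<le> x" "{1..<x} \<subseteq> set u" "1 \<le> h x" "{1..<h x} \<subseteq> set u"
    using snoc.prems IH by (auto simp: restricted_growth_snoc)
  have "h x = x"
  proof (cases "x < h x \<or> h x < x")
    case True
    then have "x \<in> set u \<or> h x \<in> set u" using a by auto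
    then show ?thesis
      using h snoc.prems(3) by (auto simp: inj_on_def)
  qed auto
  then show ?case using IH by simp
qed simp

section \<open>Canonical sequential forms are exactly the restricted growth words\<close>

lemma canonical_sequential_form_imp_restricted_growth:
  assumes P: "partition_on {1..n} P" and w: "canonical_sequential_form n P w"
  shows "restricted_growth w"
proof -
  obtain Bs where len: "length w = n" and Bs: "set Bs = P"
    and srt: "sorted_wrt (\<lambda>B C. Min B < Min C) Bs"
    and ix: "\<And>i. i \<in> {1..n} \<Longrightarrow> w ! (i - 1) \<in> {1..length Bs} \<and> i \<in> Bs ! (w ! (i - 1) - 1)"
    using w unfolding canonical_sequential_form_def by blast
  have mn: "Min (Bs ! j) < Min (Bs ! k)" if "j < k" "k < length Bs" for j k
    using srt that by (simp add: sorted_wrt_iff_nth_less)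
  have blk: "Bs ! j \<noteq> {}" "Bs ! j \<subseteq> {1..n}" "finite (Bs ! j)" if "j < length Bs" for j
  proof -
    have "Bs ! j \<in> P" using Bs that by auto
    then show "Bs ! j \<noteq> {}" "Bs ! j \<subseteq> {1..n}" using P by (auto simp: partition_on_def)
    then show "finite (Bs ! j)" using finite_subset by blast
  qed
  \<comment> \<open>Different indices carry different blocks because their minima differ, and
    different blocks are disjoint.\<close>
  have dj: "j = k" if "j < length Bs" "k < length Bs" "i \<in> Bs ! j" "i \<in> Bs ! k" for i j k
  proof -
    have "Bs ! j = Bs ! k"
      using P Bs that unfolding partition_on_def disjoint_def by (metis IntI empty_iff nth_mem)
    then show ?thesis using mn that by (metis less_irrefl linorder_neqE_nat)
  qed
  show ?thesis
    unfolding restricted_growth_def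
  proof (intro allI impI conjI subsetI)
    fix i assume i: "i < length w"
    then have wi: "w ! i \<in> {1..length Bs}" "i + 1 \<in> Bs ! (w ! i - 1)"
      using ix[of "i + 1"] len by auto
    then show "1 \<le> w ! i" by simp
    fix x assume x: "x \<in> {1..<w ! i}"
    \<comment> \<open>The position where letter \<open>x\<close> must have appeared: block
      \<open>x\<close> precedes block \<open>w ! i\<close> in the list, so its minimum comes before
      position \<open>i + 1\<close>.\<close>
    define j where "j = Min (Bs ! (x - 1))"
    have xl: "x - 1 < length Bs" "w ! i - 1 < length Bs" "x - 1 < w ! i - 1"
      using x wi(1) by auto
    have "j < Min (Bs ! (w ! i - 1))" using mn xl j_def by blast
    moreover have "Min (Bs ! (w ! i - 1)) \<le> i + 1" using wi blk xl by simp
    ultimately have jl: "j < i + 1" by simp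
    have jB: "j \<in> Bs ! (x - 1)" using blk xl unfolding j_def by (intro Min_in) auto
    then have j: "j \<in> {1..n}" using blk xl by blast
    have wj: "w ! (j - 1) \<in> {1..length Bs}" "j \<in> Bs ! (w ! (j - 1) - 1)"
      using ix[OF j] by auto
    have "w ! (j - 1) - 1 = x - 1"
      using dj[of "w ! (j - 1) - 1" "x - 1" j] wj jB xl by auto
    then have "w ! (j - 1) = x" using wj x by auto
    moreover have "j - 1 < i" using jl j by auto
    ultimately show "x \<in> set (take i w)"
      using i by (auto simp: in_set_conv_nth)
  qed
qed

text \<open>The blocks are the level sets of \<open>w\<close>. By restricted growth the letters 1,
  2, ... make their first appearances in this order, so the level sets are sorted by their
  minima.\<close>

lemma restricted_growth_imp_canonical_sequential_form:
  assumes w: "restricted_growth w" and len: "length w = n"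
  shows "\<exists>P. partition_on {1..n} P \<and> canonical_sequential_form n P w"
proof -
  define k where "k = card (set w)"
  have sw: "set w = {1..k}" using set_restricted_growth[OF w] k_def by simp
  define B where "B = (\<lambda>j. {i \<in> {1..n}. w ! (i - 1) = j})"
  define Bs where "Bs = map B [1..<k + 1]"
  have B_ne: "B j \<noteq> {}" if j: "j \<in> {1..k}" for j
  proof -
    obtain i where "i < n" "w ! i = j" using j sw len by (metis in_set_conv_nth)
    then have "i + 1 \<in> B j" by (simp add: B_def)
    then show ?thesis by blast
  qed
  have fin: "finite (B j)" for j by (simp add: B_def)
  have wk: "w ! (i - 1) \<in> {1..k}" if "i \<in> {1..n}" for i
    using that len nth_mem[of "i - 1" w] unfolding sw by fastforce
  have mn: "Min (B x) < Min (B y)" if xy: "x < y" "x \<in> {1..k}" "y \<in> {1..k}" for x y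
  proof -
    have m: "Min (B y) \<in> B y" using B_ne fin xy by (intro Min_in) auto
    define i where "i = Min (B y) - 1"
    have i: "i < n" "w ! i = y" "Min (B y) = i + 1" using m by (auto simp: B_def i_def)
    then have "{1..<y} \<subseteq> set (take i w)"
      using w len unfolding restricted_growth_def by blast
    then have "x \<in> set (take i w)" using xy by auto
    then obtain i' where "i' < i" "w ! i' = x" using i len by (auto simp: in_set_conv_nth)
    then have "i' + 1 \<in> B x" using i by (simp add: B_def)
    then have "Min (B x) \<le> i' + 1" using fin by simp
    then show ?thesis using \<open>i' < i\<close> i by simp
  qed
  have "partition_on {1..n} (B ` {1..k})"
  proof (rule partition_onI)
    show "\<Union>(B ` {1..k}) = {1..n}" using wk by (fastforce simp: B_def)
    show "{} \<notin> B ` {1..k}" using B_ne by blast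
    show "disjnt p q" if "p \<in> B ` {1..k}" "q \<in> B ` {1..k}" "p \<noteq> q" for p q
      using that by (auto simp: B_def disjnt_def)
  qed
  moreover have "set Bs = B ` {1..k}"
    unfolding Bs_def by (simp add: atLeastLessThanSuc_atLeastAtMost del: upt_Suc)
  moreover have "sorted_wrt (\<lambda>B C. Min B < Min C) Bs"
    unfolding Bs_def sorted_wrt_map
    by (rule sorted_wrt_mono_rel[OF _ sorted_wrt_upt])
       (use mn in \<open>auto simp del: upt_Suc\<close>)
  moreover have "w ! (i - 1) \<in> {1..length Bs} \<and> i \<in> Bs ! (w ! (i - 1) - 1)" if "i \<in> {1..n}" for i
    using wk[OF that] that by (auto simp: Bs_def B_def simp del: upt_Suc)
  ultimately show ?thesis
    using len unfolding canonical_sequential_form_def by blast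
qed

section \<open>Non-crossing partitions as words\<close>

definition nc_word :: "nat list \<Rightarrow> bool" where
  "nc_word w \<longleftrightarrow> restricted_growth w \<and> noncrossing w"

lemma NC_eq: "NC n = {w. length w = n \<and> nc_word w}"
proof -
  have "(\<exists>P. partition_on {1..n} P \<and> canonical_sequential_form n P w) \<longleftrightarrow>
      length w = n \<and> restricted_growth w" for w
    using canonical_sequential_form_imp_restricted_growth restricted_growth_imp_canonical_sequential_form
    by (meson canonical_sequential_form_def)
  then show ?thesis by (simp add: NC_def nc_word_def)
qed

lemma nc_word_Nil [simp]: "nc_word []"
  by (simp add: nc_word_def noncrossing_def)

lemma nc_word_appendD: "nc_word (u @ v) \<Longrightarrow> nc_word u"
  unfolding nc_word_def noncrossing_def
  by (blast intro: restricted_growth_appendD subseq_rev_drop_many)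

section \<open>One-letter extensions of non-crossing words\<close>

text \<open>The admissible letters. Their number is the label of \<open>w\<close> in the generating
  tree of non-crossing words.\<close>

definition next_letters :: "nat list \<Rightarrow> nat set" where
  "next_letters w = {x. nc_word (w @ [x])}"

lemma nc_word_snoc: "nc_word (w @ [x]) \<longleftrightarrow> x \<in> next_letters w"
  by (simp add: next_letters_def)

lemma next_letters_subset: "nc_word w \<Longrightarrow> next_letters w \<subseteq> {1..card (set w) + 1}"
  unfolding next_letters_def nc_word_def using restricted_growth_snoc_card by auto

lemma finite_next_letters: "nc_word w \<Longrightarrow> finite (next_letters w)"
  using next_letters_subset finite_subset by blast

text \<open>Words grow at the right end here, so an embedding is split by whether its last letter is
  matched with the appended one.\<close>

lemma subseq_snoc_cases:
  "subseq (u @ [x]) (w @ [y]) \<longleftrightarrow> subseq (u @ [x]) w \<or> x = y \<and> subseq u w"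
proof
  assume "subseq (u @ [x]) (w @ [y])"
  then show "subseq (u @ [x]) w \<or> x = y \<and> subseq u w"
  proof (cases "x = y")
    case False
    obtain v v' where v: "u @ [x] = v @ v'" "subseq v w" "subseq v' [y]"
      using \<open>subseq (u @ [x]) (w @ [y])\<close> unfolding subseq_append_iff by blast
    have "v' = []"
    proof (rule ccontr)
      assume "v' \<noteq> []"
      then have "x \<in> set v'" using v(1) by (metis last_appendR last_in_set last_snoc)
      then show False using v(3) False by (auto elim: list_emb_set)
    qed
    then show ?thesis using v by simp
  qed simp
next
  assume "subseq (u @ [x]) w \<or> x = y \<and> subseq u w"
  then show "subseq (u @ [x]) (w @ [y])"
    by (auto intro: list_emb_append_mono list_emb_append2)
qed

text \<open>A new crossing must end in the appended letter, which leaves its first three letters in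
  the old word.\<close>

lemma noncrossing_snoc:
  "noncrossing (w @ [y]) \<longleftrightarrow> noncrossing w \<and> (\<forall>c<y. \<not> subseq [c, y, c] w)"
proof -
  have "subseq [c, z, c, z] (w @ [y]) \<longleftrightarrow> subseq [c, z, c, z] w \<or> z = y \<and> subseq [c, z, c] w" for c z
    using subseq_snoc_cases[of "[c, z, c]" z w y] by simp
  then show ?thesis unfolding noncrossing_def by blast
qed

lemma next_letters_Nil: "next_letters [] = {1}"
  by (auto simp: next_letters_def nc_word_def restricted_growth_snoc[of "[]", simplified]
      noncrossing_snoc[of "[]", simplified] noncrossing_def)

lemma new_letter_in_next_letters:
  assumes "nc_word w"
  shows "card (set w) + 1 \<in> next_letters w"
proof -
  have sw: "set w = {1..card (set w)}"
    using assms set_restricted_growth nc_word_def by blast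
  have "\<not> subseq [c, card (set w) + 1, c] w" for c
  proof
    assume "subseq [c, card (set w) + 1, c] w"
    then have "card (set w) + 1 \<in> set w"
      by (auto elim: list_emb_set)
    moreover have "card (set w) + 1 \<notin> {1..card (set w)}" by simp
    ultimately show False using sw by metis
  qed
  then show ?thesis
    using assms unfolding next_letters_def nc_word_def
    by (simp add: restricted_growth_snoc_card noncrossing_snoc)
qed

text \<open>Restricted growth puts every smaller positive letter before any occurrence of
  \<open>y\<close>; this supplies the first half of a crossing.\<close>

lemma restricted_growth_subseq_pair:
  assumes "restricted_growth w" "1 \<le> x" "x < y" "y \<in> set w"
  shows "subseq [x, y] w"
proof -
  obtain u v where w: "w = u @ y # v" using assms(4) by (meson split_list)
  then have "restricted_growth (u @ [y])"
    using assms(1) restricted_growth_appendD[of "u @ [y]" v] by simp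
  then have "x \<in> set u" using assms by (auto simp: restricted_growth_snoc)
  then have "subseq [x] u" by (simp add: subseq_singleton_left)
  then have "subseq ([x] @ [y]) (u @ y # v)"
    by (intro list_emb_append_mono) auto
  then show ?thesis using w by simp
qed

text \<open>A letter above \<open>x\<close> is closed off by appending \<open>x\<close>, since the smaller letter \<open>x\<close>
  occurs before its first occurrence.\<close>

lemma next_letters_snoc:
  assumes x: "x \<in> next_letters w"
  shows "next_letters (w @ [x]) = insert (card (set (w @ [x])) + 1) {y \<in> next_letters w. y \<le> x}"
proof -
  have wx: "nc_word (w @ [x])" using x by (simp add: nc_word_snoc)
  then have w: "nc_word w" by (rule nc_word_appendD)
  have rw: "restricted_growth w" and rwx: "restricted_growth (w @ [x])"
    using w wx by (auto simp: nc_word_def)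
  have xb: "1 \<le> x" "x \<le> card (set w) + 1" using x next_letters_subset[OF w] by auto
  have swx: "set (w @ [x]) = {1..card (set (w @ [x]))}" using set_restricted_growth[OF rwx] .
  show ?thesis
  proof (intro equalityI subsetI)
    fix y assume y: "y \<in> next_letters (w @ [x])"
    then have yg: "nc_word ((w @ [x]) @ [y])" by (simp only: nc_word_snoc)
    show "y \<in> insert (card (set (w @ [x])) + 1) {y \<in> next_letters w. y \<le> x}"
    proof (cases "y = card (set (w @ [x])) + 1")
      case False
      then have "y \<in> {1..card (set (w @ [x]))}"
        using y next_letters_subset[OF wx] by auto
      then have "y \<in> set (w @ [x])" using swx by metis
      have c: "\<not> subseq [c, y, c] (w @ [x])" if "c < y" for c
        using yg that noncrossing_snoc[of "w @ [x]" y] by (simp add: nc_word_def)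
      have "y \<le> x"
      proof (rule ccontr)
        assume yx: "\<not> y \<le> x"
        then have "y \<in> set w" using \<open>y \<in> set (w @ [x])\<close> by auto
        then have "subseq [x, y] w" using restricted_growth_subseq_pair[OF rw] xb yx by auto
        then have "subseq [x, y, x] (w @ [x])" using subseq_snoc_cases[of "[x, y]" x w x] by simp
        then show False using c yx by auto
      qed
      moreover have "noncrossing (w @ [y])"
        unfolding noncrossing_snoc
      proof (intro conjI allI impI notI)
        show "noncrossing w" using w nc_word_def by blast
        fix z assume "z < y" "subseq [z, y, z] w"
        then show False using c[of z] subseq_rev_drop_many by blast
      qed
      moreover have "1 \<le> y" using \<open>y \<in> set (w @ [x])\<close> swx by auto
      ultimately show ?thesis
        using rw xb by (auto simp: next_letters_def nc_word_def restricted_growth_snoc_card)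
    qed simp
  next
    fix y assume "y \<in> insert (card (set (w @ [x])) + 1) {y \<in> next_letters w. y \<le> x}"
    then consider "y = card (set (w @ [x])) + 1" | "y \<in> next_letters w" "y \<le> x" by auto
    then show "y \<in> next_letters (w @ [x])"
    proof cases
      case 1
      then show ?thesis using new_letter_in_next_letters[OF wx] by simp
    next
      case 2
      then have wy: "nc_word (w @ [y])" by (simp add: nc_word_snoc)
      then have "1 \<le> y" "{1..<y} \<subseteq> set (w @ [x])"
        by (auto simp: nc_word_def restricted_growth_snoc)
      \<comment> \<open>A pattern \<open>c y c\<close> not already in \<open>w\<close> would end in
        the appended letter, forcing \<open>c = x\<close>, which \<open>c < y\<close> and
        \<open>y \<le> x\<close> exclude.\<close>
      moreover have "\<not> subseq [c, y, c] (w @ [x])" if "c < y" for c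
        using subseq_snoc_cases[of "[c, y]" c w x] wy that 2
        by (auto simp: nc_word_def noncrossing_snoc)
      ultimately have "nc_word ((w @ [x]) @ [y])"
        unfolding nc_word_def using wx
        by (auto simp only: restricted_growth_snoc noncrossing_snoc nc_word_def)
      then show ?thesis by (simp only: nc_word_snoc)
    qed
  qed
qed

text \<open>The new letter above the maximum exceeds \<open>x\<close>, so it is not among the
  letters kept: appending the admissible letter of rank \<open>j\<close> leaves \<open>j + 1\<close>
  admissible letters.\<close>

lemma card_next_letters_snoc:
  assumes x: "x \<in> next_letters w"
  shows "card (next_letters (w @ [x])) = Suc (card {y \<in> next_letters w. y \<le> x})"
proof -
  have wx: "nc_word (w @ [x])" using x by (simp add: nc_word_snoc)
  have "x \<in> {1..card (set (w @ [x]))}"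
    using set_restricted_growth[of "w @ [x]"] wx nc_word_def by (metis in_set_conv_decomp)
  moreover have "finite (next_letters w)" using finite_next_letters nc_word_appendD wx by blast
  ultimately show ?thesis by (simp add: next_letters_snoc[OF x])
qed

section \<open>Counting extensions\<close>

text \<open>The number of nodes \<open>n\<close> levels below a node labelled \<open>s\<close> in
  the tree where such a node has children labelled 2, ..., \<open>s + 1\<close>.\<close>

fun ballot :: "nat \<Rightarrow> nat \<Rightarrow> nat" where
  "ballot 0 s = 1"
| "ballot (Suc n) s = (\<Sum>j=1..s. ballot n (Suc j))"

text \<open>The ballot number as a difference of two neighbouring binomial coefficients, written
  additively to avoid truncated subtraction.\<close>

lemma ballot_binomial:
  "ballot (Suc n) (Suc k) + (2 * n + 2 + k choose n) = (2 * n + 2 + k choose Suc n)"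
proof (induction n arbitrary: k)
  case (Suc n)
  note IH = Suc.IH
  show ?case
  proof (induction k)
    case 0
    \<comment> \<open>A node labelled 1 has one child, labelled 2, so the outer hypothesis applies
      with \<open>k = 1\<close>; Pascal's rule and this symmetry of the odd row do the rest.\<close>
    have "(2 * n + 3 choose Suc (Suc n)) = (2 * n + 3 choose Suc n)"
      using binomial_symmetric[of "Suc n" "2 * n + 3"] by simp
    then show ?case using IH[of 1] by (simp add: numeral_eq_Suc)
  next
    case (Suc k)
    \<comment> \<open>Raising the label by 1 adds a single child, labelled \<open>k + 3\<close>,
      which the outer hypothesis covers at \<open>k + 2\<close>.\<close>
    have "ballot (Suc (Suc n)) (Suc (Suc k)) = ballot (Suc (Suc n)) (Suc k) + ballot (Suc n) (Suc (k + 2))"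
      by simp
    moreover have "(2 * Suc n + 2 + Suc k choose Suc j) =
        (2 * Suc n + 2 + k choose Suc j) + (2 * Suc n + 2 + k choose j)" for j
      by simp
    moreover have "2 * n + 2 + (k + 2) = 2 * Suc n + 2 + k" by simp
    ultimately show ?case using Suc IH[of "k + 2"] by presburger
  qed
qed simp

text \<open>\<open>ballot r 1\<close> is the Catalan number, the difference of the binomial
  coefficients of \<open>2 * r\<close> over \<open>r\<close> and over \<open>r + 1\<close>. Since
  \<open>r\<close> times the first is \<open>r + 1\<close> times the second, multiplying by
  \<open>r\<close> leaves the second.\<close>

lemma ballot_catalan: "r * ballot r 1 = (2 * r choose (r + 1))"
proof (cases r)
  case (Suc n)
  have b: "ballot r 1 + (2 * r choose n) = (2 * r choose r)"
    using ballot_binomial[of n 0] Suc by simp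
  have s: "(2 * r choose n) = (2 * r choose (r + 1))"
    using binomial_symmetric[of n "2 * r"] Suc by simp
  have "(r + 1) * (2 * r choose (r + 1)) = r * (2 * r choose r)"
    using Suc_times_binomial_add[of r n] Suc by (simp add: mult_2)
  then have "r * ballot r 1 + r * (2 * r choose (r + 1)) = (r + 1) * (2 * r choose (r + 1))"
    using b s by (metis add_mult_distrib2)
  then show ?thesis by simp
qed simp

text \<open>The rank maps \<open>N\<close> bijectively onto 1, ..., \<open>card N\<close>; adjoining
  a new maximum leaves the other ranks alone.\<close>

lemma sum_rank:
  fixes N :: "nat set" and h :: "nat \<Rightarrow> nat"
  assumes "finite N"
  shows "(\<Sum>x\<in>N. h (card {y \<in> N. y \<le> x})) = (\<Sum>j=1..card N. h j)"
  using assms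
proof (induction N rule: finite_linorder_max_induct)
  case (insert b A)
  have "{y \<in> insert b A. y \<le> x} = {y \<in> A. y \<le> x}" if "x \<in> A" for x
    using insert that by auto
  moreover have "{y \<in> insert b A. y \<le> b} = insert b A" "b \<notin> A" using insert by auto
  ultimately show ?case using insert by simp
qed simp

section \<open>Extensions of a word are counted by ballot numbers\<close>

definition extensions :: "nat \<Rightarrow> nat list \<Rightarrow> nat list set" where
  "extensions n w = {s. length s = n \<and> nc_word (w @ s)}"

lemma extensions_Suc:
  "extensions (Suc n) w = (\<Union>x\<in>next_letters w. (#) x ` extensions n (w @ [x]))"
proof (intro equalityI subsetI)
  fix s assume s: "s \<in> extensions (Suc n) w"
  then obtain x t where xt: "s = x # t" "length t = n" "nc_word ((w @ [x]) @ t)"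
    by (auto simp: extensions_def length_Suc_conv)
  then have "x \<in> next_letters w" using nc_word_appendD nc_word_snoc by blast
  then show "s \<in> (\<Union>x\<in>next_letters w. (#) x ` extensions n (w @ [x]))"
    using xt by (auto simp: extensions_def)
qed (auto simp: extensions_def)

text \<open>Split by the first appended letter and replace letters by their ranks. The count depends
  on \<open>w\<close> only through its number of admissible letters, so words with equally many are
  interchangeable as prefixes.\<close>

lemma card_extensions:
  "nc_word w \<Longrightarrow> finite (extensions n w) \<and> card (extensions n w) = ballot n (card (next_letters w))"
proof (induction n arbitrary: w)
  case 0
  have "extensions 0 w = {[]}" using 0 by (auto simp: extensions_def)
  then show ?case by simp
next
  case (Suc n)
  have fin: "finite (next_letters w)" by (rule finite_next_letters) fact
  have IH: "finite (extensions n (w @ [x]))"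
    "card (extensions n (w @ [x])) = ballot n (Suc (card {y \<in> next_letters w. y \<le> x}))"
    if "x \<in> next_letters w" for x
    using Suc.IH[of "w @ [x]"] that by (auto simp: nc_word_snoc card_next_letters_snoc)
  have "card (extensions (Suc n) w) = (\<Sum>x\<in>next_letters w. card ((#) x ` extensions n (w @ [x])))"
    unfolding extensions_Suc by (rule card_UN_disjoint) (use fin IH in auto)
  also have "\<dots> = (\<Sum>x\<in>next_letters w. ballot n (Suc (card {y \<in> next_letters w. y \<le> x})))"
    using IH by (intro sum.cong) (auto simp: card_image)
  also have "\<dots> = ballot (Suc n) (card (next_letters w))"
    using sum_rank[OF fin, of "\<lambda>j. ballot n (Suc j)"] by simp
  finally show ?case using fin IH by (simp add: extensions_Suc)
qed

lemma NC_extensions: "NC n = extensions n []"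
  by (simp add: NC_eq extensions_def)

lemma finite_NC: "finite (NC n)"
  using card_extensions[of "[]"] by (simp add: NC_extensions)

lemma card_NC: "card (NC n) = ballot n 1"
  using card_extensions[of "[]" n] by (simp add: NC_extensions next_letters_Nil)

lemma NC_add: "card (NC (k + n)) = (\<Sum>u\<in>NC k. card (extensions n u))"
proof -
  have "NC (k + n) = (\<Union>u\<in>NC k. (@) u ` extensions n u)"
  proof (intro equalityI subsetI)
    fix w assume w: "w \<in> NC (k + n)"
    then have "take k w \<in> NC k" "drop k w \<in> extensions n (take k w)"
      using nc_word_appendD[of "take k w" "drop k w"] by (auto simp: NC_eq extensions_def)
    moreover have "w = take k w @ drop k w" by simp
    ultimately show "w \<in> (\<Union>u\<in>NC k. (@) u ` extensions n u)" by blast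
  qed (auto simp: NC_eq extensions_def)
  moreover have "card (\<Union>u\<in>NC k. (@) u ` extensions n u) = (\<Sum>u\<in>NC k. card ((@) u ` extensions n u))"
  proof (rule card_UN_disjoint)
    show "\<forall>u\<in>NC k. finite ((@) u ` extensions n u)"
      using card_extensions by (auto simp: NC_eq)
    show "finite (NC k)" by (rule finite_NC)
  qed (auto simp: NC_eq)
  moreover have "card ((@) u ` extensions n u) = card (extensions n u)" for u :: "nat list"
    by (simp add: card_image inj_on_def)
  ultimately show ?thesis by simp
qed

section \<open>Inserting a pattern\<close>

text \<open>Once \<open>x\<close> has been appended, the admissible letters are some up to
  \<open>x\<close>, including \<open>x\<close>, and the one above the maximum; further copies of
  \<open>x\<close> discard none and leave the maximum alone.\<close>

lemma next_letters_replicate: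
  assumes "x \<in> next_letters w" "b \<ge> 1"
  shows "nc_word (w @ replicate b x)"
    and "next_letters (w @ replicate b x) =
      insert (card (set (w @ [x])) + 1) {y \<in> next_letters w. y \<le> x}"
proof -
  have "nc_word (w @ replicate b x) \<and> next_letters (w @ replicate b x) =
      insert (card (set (w @ [x])) + 1) {y \<in> next_letters w. y \<le> x}"
    using assms(2)
  proof (induction b rule: nat_induct_at_least)
    case base
    then show ?case using assms(1) by (simp add: nc_word_snoc next_letters_snoc)
  next
    case (Suc n)
    have wx: "nc_word (w @ [x])" using assms(1) by (simp add: nc_word_snoc)
    have "x \<in> {1..card (set (w @ [x]))}"
      using set_restricted_growth[of "w @ [x]"] wx nc_word_def by (metis in_set_conv_decomp)
    moreover have "x \<in> next_letters (w @ replicate n x)" using Suc assms(1) by auto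
    moreover have "w @ replicate (Suc n) x = (w @ replicate n x) @ [x]"
      by (simp add: replicate_append_same)
    ultimately show ?case
      using Suc by (auto simp: nc_word_snoc next_letters_snoc simp del: replicate_Suc append_assoc)
  qed
  then show "nc_word (w @ replicate b x)" "next_letters (w @ replicate b x) =
      insert (card (set (w @ [x])) + 1) {y \<in> next_letters w. y \<le> x}" by auto
qed

text \<open>Above \<open>M\<close> the shifted copy of \<open>v\<close> evolves as \<open>v\<close>
  does from the empty word, and appending letters above \<open>M\<close> closes off nothing up to
  \<open>M\<close>.\<close>

lemma next_letters_append_shift:
  assumes u: "nc_word u" and M: "M = card (set u)" and v: "nc_word v"
  shows "nc_word (u @ map (\<lambda>x. x + M) v) \<and>
    next_letters (u @ map (\<lambda>x. x + M) v) = {y \<in> next_letters u. y \<le> M} \<union> (\<lambda>x. x + M) ` next_letters v"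
  using v
proof (induction v rule: rev_induct)
  case Nil
  then show ?case
    using u new_letter_in_next_letters[OF u] next_letters_subset[OF u] M
    by (auto simp: next_letters_Nil)
next
  case (snoc x v)
  let ?s = "\<lambda>x. x + M"
  have v: "nc_word v" and x: "x \<in> next_letters v"
    using snoc.prems nc_word_appendD nc_word_snoc by blast+
  have IH: "nc_word (u @ map ?s v)"
    "next_letters (u @ map ?s v) = {y \<in> next_letters u. y \<le> M} \<union> ?s ` next_letters v"
    using snoc.IH[OF v] by auto
  then have xs: "?s x \<in> next_letters (u @ map ?s v)" using x by auto
  have ru: "set u = {1..M}" using set_restricted_growth u M nc_word_def by metis
  have rv: "set (v @ [x]) = {1..card (set (v @ [x]))}"
    using set_restricted_growth snoc.prems nc_word_def by blast
  have "set u \<inter> ?s ` set (v @ [x]) = {}"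
    unfolding ru by (subst rv) auto
  then have "card (set u \<union> ?s ` set (v @ [x])) = M + card (set (v @ [x]))"
    by (subst card_Un_disjoint) (auto simp: M card_image inj_on_def simp del: set_append)
  moreover have "set ((u @ map ?s v) @ [?s x]) = set u \<union> ?s ` set (v @ [x])" by auto
  ultimately have c: "card (set ((u @ map ?s v) @ [?s x])) = M + card (set (v @ [x]))" by simp
  have "next_letters ((u @ map ?s v) @ [?s x]) =
      insert (M + card (set (v @ [x])) + 1) {y \<in> next_letters (u @ map ?s v). y \<le> ?s x}"
    using next_letters_snoc[OF xs] c by simp
  also have "\<dots> = {y \<in> next_letters u. y \<le> M} \<union>
      ?s ` insert (card (set (v @ [x])) + 1) {y \<in> next_letters v. y \<le> x}"
    unfolding IH by auto
  also have "\<dots> = {y \<in> next_letters u. y \<le> M} \<union> ?s ` next_letters (v @ [x])"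
    using next_letters_snoc[OF x] by simp
  finally show ?case using xs by (simp add: nc_word_snoc[of "u @ map ?s v", simplified])
qed

text \<open>The one possible occurrence of the pattern after \<open>p\<close> with enclosing letter
  \<open>x\<close>. The shift is the maximum of \<open>p @ [x]\<close>, not of \<open>p\<close>,
  since \<open>x\<close> may itself be new.\<close>

definition inserted :: "nat \<Rightarrow> nat list \<Rightarrow> nat \<Rightarrow> nat list \<Rightarrow> nat \<Rightarrow> nat list" where
  "inserted a \<rho> b p x =
     replicate a x @ map (\<lambda>y. y + card (set (p @ [x]))) \<rho> @ replicate b x"

text \<open>The closing run of \<open>x\<close> cuts off what \<rho> made admissible, leaving the
  letters up to \<open>x\<close> admissible for \<open>p\<close> and one new letter, as after a
  single \<open>x\<close>. That new letter may differ, so only cardinalities are compared.\<close>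

lemma nc_word_inserted:
  assumes px: "nc_word (p @ [x])" and ab: "a \<ge> 1" "b \<ge> 1" and \<rho>: "nc_word \<rho>"
  shows "nc_word (p @ inserted a \<rho> b p x) \<and>
    card (next_letters (p @ inserted a \<rho> b p x)) = card (next_letters (p @ [x]))"
proof -
  define M where "M = card (set (p @ [x]))"
  define u where "u = p @ replicate a x"
  define v where "v = u @ map (\<lambda>y. y + M) \<rho>"
  have x: "x \<in> next_letters p" using px by (simp add: nc_word_snoc)
  have xM: "x \<in> {1..M}"
    unfolding M_def using set_restricted_growth[of "p @ [x]"] px nc_word_def by (metis in_set_conv_decomp)
  have fin: "finite (next_letters p)" using finite_next_letters nc_word_appendD px by blast
  have u: "nc_word u" "next_letters u = insert (M + 1) {y \<in> next_letters p. y \<le> x}"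
    using next_letters_replicate[OF x ab(1)] by (auto simp: u_def M_def)
  have "set u = set (p @ [x])" using ab by (auto simp: u_def)
  then have Mu: "M = card (set u)" by (simp add: M_def)
  have v: "nc_word v" "next_letters v = {y \<in> next_letters u. y \<le> M} \<union> (\<lambda>x. x + M) ` next_letters \<rho>"
    using next_letters_append_shift[OF u(1) Mu \<rho>] by (auto simp: v_def)
  have xv: "x \<in> next_letters v" using v u x xM by auto
  have "nc_word (v @ replicate b x)" "next_letters (v @ replicate b x) =
      insert (card (set (v @ [x])) + 1) {y \<in> next_letters v. y \<le> x}"
    using next_letters_replicate[OF xv ab(2)] by auto
  \<comment> \<open>The admissible letters stemming from \<rho> exceed \<open>M\<close> and hence
    \<open>x\<close>.\<close>
  moreover have "{y \<in> next_letters v. y \<le> x} = {y \<in> next_letters p. y \<le> x}"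
    using v u xM next_letters_subset[OF \<rho>] by auto
  moreover have "card (set (v @ [x])) + 1 \<notin> {y \<in> next_letters p. y \<le> x}"
  proof -
    have "set (p @ [x]) \<subseteq> set (v @ [x])" by (auto simp: v_def u_def)
    then have "M \<le> card (set (v @ [x]))" unfolding M_def by (intro card_mono) auto
    then show ?thesis using xM by auto
  qed
  ultimately show ?thesis
    using fin card_next_letters_snoc[OF x] by (simp add: inserted_def v_def u_def M_def)
qed

section \<open>Occurrences of the pattern\<close>

text \<open>Passes from comparing positions to relabelling letters, so that an occurrence can be
  read off factor by factor.\<close>

lemma order_isomorphic_iff_map:
  "order_isomorphic u v \<longleftrightarrow> (\<exists>f. strict_mono_on (set v) f \<and> u = map f v)"
proof
  assume uv: "order_isomorphic u v"
  \<comment> \<open>The least index carrying \<open>z\<close> is a mere choice: equal letters of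
    \<open>v\<close> face equal letters of \<open>u\<close>.\<close>
  define f where "f = (\<lambda>z. u ! (LEAST j. j < length v \<and> v ! j = z))"
  have len: "length u = length v" using uv by (simp add: order_isomorphic_def)
  have f: "f (v ! i) = u ! i" if "i < length v" for i
  proof -
    let ?j = "LEAST j. j < length v \<and> v ! j = v ! i"
    have "?j < length v \<and> v ! ?j = v ! i"
      using LeastI[of "\<lambda>j. j < length v \<and> v ! j = v ! i" i] that by blast
    then have "u ! ?j = u ! i" using uv that len unfolding order_isomorphic_def by metis
    then show ?thesis by (simp add: f_def)
  qed
  have "strict_mono_on (set v) f"
    using uv f by (auto simp: strict_mono_on_def in_set_conv_nth order_isomorphic_def)
  moreover have "u = map f v" using len f by (intro nth_equalityI) auto
  ultimately show "\<exists>f. strict_mono_on (set v) f \<and> u = map f v" by blast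
next
  assume "\<exists>f. strict_mono_on (set v) f \<and> u = map f v"
  then obtain f where f: "strict_mono_on (set v) f" and u: "u = map f v" by blast
  show "order_isomorphic u v"
    unfolding order_isomorphic_def u
  proof (intro conjI allI impI)
    fix i j assume "i < length (map f v)" "j < length (map f v)"
    then have ij: "i < length v" "j < length v" "v ! i \<in> set v" "v ! j \<in> set v" by auto
    show "(map f v ! i < map f v ! j) = (v ! i < v ! j)"
      using ij strict_mono_on_less[OF f] by simp
    show "(map f v ! i = map f v ! j) = (v ! i = v ! j)"
      using ij strict_mono_on_eqD[OF f] by auto
  qed simp
qed

text \<open>The letters of \<open>\<rho> + 1\<close> exceed the enclosing letter \<open>x\<close>, so in a non-crossing word
  none of them has occurred before; restricted growth then determines them.\<close>

lemma nc_word_order_isomorphic_iff: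
  assumes ab: "a \<ge> 1" "b \<ge> 1" and \<rho>: "nc_word \<rho>"
    and w: "nc_word (p @ v)"
  shows "order_isomorphic v (replicate a 1 @ map (\<lambda>x. x + 1) \<rho> @ replicate b 1) \<longleftrightarrow>
    (\<exists>x. nc_word (p @ [x]) \<and> v = inserted a \<rho> b p x)"
    (is "order_isomorphic v ?\<tau> \<longleftrightarrow> _")
proof -
  have s\<tau>: "set ?\<tau> = insert 1 (Suc ` set \<rho>)" using ab by auto
  have \<rho>pos: "y \<ge> 1" if "y \<in> set \<rho>" for y
    using \<rho> that set_restricted_growth unfolding nc_word_def by fastforce
  show ?thesis
  proof
    assume "order_isomorphic v ?\<tau>"
    then obtain f where f: "strict_mono_on (insert 1 (Suc ` set \<rho>)) f" and v: "v = map f ?\<tau>"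
      unfolding order_isomorphic_iff_map s\<tau> by blast
    define x where "x = f 1"
    define M where "M = card (set (p @ [x]))"
    define t where "t = map (\<lambda>y. f (Suc y)) \<rho>"
    have vt: "v = replicate a x @ t @ replicate b x" by (simp add: v x_def t_def)
    have rax: "replicate a x = [x] @ replicate (a - 1) x" using ab by (cases a) auto
    have rbx: "replicate b x = [x] @ replicate (b - 1) x" using ab by (cases b) auto
    have px: "nc_word (p @ [x])"
      using w nc_word_appendD[of "p @ [x]"] by (simp add: vt rax)
    have Mset: "set (p @ [x]) = {1..M}"
      using px set_restricted_growth nc_word_def M_def by blast
    have tx: "x < y" if y: "y \<in> set t" for y
    proof -
      obtain z where z: "z \<in> set \<rho>" "y = f (Suc z)" using y by (auto simp: t_def)
      then show ?thesis
        using strict_mono_onD[OF f, of 1 "Suc z"] \<rho>pos[of z] by (simp add: x_def)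
    qed
    have rg: "restricted_growth (p @ v)" using w nc_word_def by simp
    have rt: "restricted_growth (p @ replicate a x @ t)"
      using rg restricted_growth_appendD[of "p @ replicate a x @ t"] by (simp add: vt)
    \<comment> \<open>Otherwise \<open>y\<close> is an old letter of \<open>p\<close>, preceded
      there by \<open>x\<close>; the opening run and \<open>t\<close> then complete the crossing
      \<open>x y x y\<close>.\<close>
    have tM: "M < y" if y: "y \<in> set t" for y
    proof (rule ccontr)
      assume "\<not> M < y"
      moreover have "x \<ge> 1" using Mset by auto
      ultimately have "y \<in> set (p @ [x])" using tx[OF y] Mset by auto
      then have "y \<in> set p" using tx[OF y] by auto
      then have "subseq [x, y] p"
        using restricted_growth_subseq_pair[of p x y] px tx[OF y] \<open>x \<ge> 1\<close> restricted_growth_appendD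
        unfolding nc_word_def by blast
      moreover have "subseq [x] (replicate a x)" by (simp add: rax)
      moreover have "subseq [y] t" using y by (simp add: subseq_singleton_left)
      ultimately have "subseq ([x, y] @ [x] @ [y]) (p @ replicate a x @ t)"
        by (intro list_emb_append_mono)
      then have "subseq [x, y, x, y] (p @ v)"
        unfolding vt by (auto intro: subseq_order.trans[OF _ prefix_imp_subseq])
      then show False using w tx[OF y] unfolding nc_word_def noncrossing_def by blast
    qed
    \<comment> \<open>All letters of \<open>t\<close> exceed \<open>M\<close>, so the subtraction is
      injective on them; it yields a restricted growth word that relabels \<rho>, hence \<rho>
      itself.\<close>
    let ?h = "\<lambda>y. f (Suc y) - M"
    have tMh: "map ?h \<rho> = map (\<lambda>y. y - M) t" by (simp add: t_def)
    have "restricted_growth (map (\<lambda>y. y - M) t)"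
      unfolding restricted_growth_def
    proof (intro allI impI conjI subsetI)
      fix i assume "i < length (map (\<lambda>y. y - M) t)"
      then have i: "i < length t" by simp
      then show "1 \<le> map (\<lambda>y. y - M) t ! i" using tM[of "t ! i"] by simp
      fix z assume z: "z \<in> {1..<map (\<lambda>y. y - M) t ! i}"
      define k where "k = length (p @ replicate a x) + i"
      have "k < length (p @ replicate a x @ t)" "(p @ replicate a x @ t) ! k = t ! i"
        "take k (p @ replicate a x @ t) = p @ replicate a x @ take i t"
        using i by (auto simp: k_def nth_append)
      \<comment> \<open>The letter \<open>z + M\<close> must occur earlier; exceeding
        \<open>M\<close>, it cannot lie in \<open>p\<close> or the opening run, so it lies in
        \<open>t\<close>.\<close>
      then have "{1..<t ! i} \<subseteq> set (p @ replicate a x) \<union> set (take i t)"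
        using rt unfolding restricted_growth_def by (metis append_assoc set_append)
      moreover have "z + M \<in> {1..<t ! i}" using z i by auto
      moreover have "set (p @ replicate a x) = {1..M}" using Mset ab by auto
      moreover have "z + M \<notin> {1..M}" using z by simp
      ultimately have "z + M \<in> set (take i t)" by blast
      then have "(z + M) - M \<in> (\<lambda>y. y - M) ` set (take i t)" by (rule imageI)
      then show "z \<in> set (take i (map (\<lambda>y. y - M) t))" by (simp add: take_map)
    qed
    moreover have "inj_on ?h (set \<rho>)"
    proof (rule inj_onI)
      fix y z assume yz: "y \<in> set \<rho>" "z \<in> set \<rho>" "f (Suc y) - M = f (Suc z) - M"
      then have "M < f (Suc y)" "M < f (Suc z)" using tM by (auto simp: t_def)
      then have "f (Suc y) = f (Suc z)" using yz by simp
      then have "Suc y = Suc z" using strict_mono_on_eqD[OF f] yz by blast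
      then show "y = z" by simp
    qed
    ultimately have h: "map ?h \<rho> = \<rho>"
      using restricted_growth_map_inj_eq[of \<rho> ?h] \<rho> tMh nc_word_def by metis
    have "t = map (\<lambda>y. y + M) (map (\<lambda>y. y - M) t)"
      using tM by (simp add: map_idI less_imp_le)
    then have "t = map (\<lambda>y. y + M) \<rho>" using h tMh by metis
    then show "\<exists>x. nc_word (p @ [x]) \<and> v = inserted a \<rho> b p x"
      using px vt by (auto simp: inserted_def M_def)
  next
    assume "\<exists>x. nc_word (p @ [x]) \<and> v = inserted a \<rho> b p x"
    then obtain x where px: "nc_word (p @ [x])" and v: "v = inserted a \<rho> b p x" by blast
    define M where "M = card (set (p @ [x]))"
    have xM: "x \<in> {1..M}"
      unfolding M_def using set_restricted_growth[of "p @ [x]"] px nc_word_def by (metis in_set_conv_decomp)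
    \<comment> \<open>The letter 1 becomes \<open>x\<close>, and the letter \<open>y\<close> of
      \<rho>, which the pattern shows as \<open>y + 1\<close>, becomes \<open>y + M\<close>. This is
      increasing because \<open>x \<le> M\<close>.\<close>
    define f where "f = (\<lambda>y. if y = 1 then x else y - 1 + M)"
    have "map f (map (\<lambda>x. x + 1) \<rho>) = map (\<lambda>y. y + M) \<rho>"
      using \<rho>pos by (fastforce simp: f_def)
    then have "v = map f ?\<tau>"
      by (simp add: v inserted_def M_def f_def)
    moreover have "strict_mono_on (set ?\<tau>) f"
      using xM \<rho>pos unfolding s\<tau> by (fastforce simp: strict_mono_on_def f_def)
    ultimately show "order_isomorphic v ?\<tau>" unfolding order_isomorphic_iff_map by blast
  qed
qed

text \<open>Contracting the occurrence to its enclosing letter turns its prefix into a word of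
  length \<open>i + 1\<close> with equally many admissible letters, hence equally many continuations
  of length \<open>k\<close>. The count is thus that of all non-crossing words of length
  \<open>i + 1 + k\<close>.\<close>

lemma card_NC_occurrence_at:
  assumes ab: "a \<ge> 1" "b \<ge> 1" and \<rho>: "nc_word \<rho>"
    and \<tau>: "\<tau> = replicate a 1 @ map (\<lambda>x. x + 1) \<rho> @ replicate b 1"
  shows "card {w \<in> NC (i + length \<tau> + k). order_isomorphic (take (length \<tau>) (drop i w)) \<tau>} =
    ballot (i + 1 + k) 1"
    (is "card ?S = _")
proof -
  let ?g = "\<lambda>u. butlast u @ inserted a \<rho> b (butlast u) (last u)"
  let ?T = "\<Union>u\<in>NC (i + 1). (@) (?g u) ` extensions k (?g u)"
  have leng: "length (inserted a \<rho> b p x) = length \<tau>" for p x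
    by (simp add: inserted_def \<tau>)
  have NC1: "\<exists>p x. u = p @ [x] \<and> length p = i \<and> nc_word (p @ [x])" if "u \<in> NC (i + 1)" for u
  proof -
    have "u \<noteq> []" using that by (auto simp: NC_eq)
    then show ?thesis
      using that by (intro exI[of _ "butlast u"] exI[of _ "last u"]) (auto simp: NC_eq)
  qed
  have g: "nc_word (?g u)" "card (next_letters (?g u)) = card (next_letters u)"
    "length (?g u) = i + length \<tau>" if "u \<in> NC (i + 1)" for u
    using NC1[OF that] nc_word_inserted[OF _ ab \<rho>] leng by auto
  have "?S = ?T"
  proof (intro equalityI subsetI)
    fix w assume w: "w \<in> ?S"
    define p v s where "p = take i w" and "v = take (length \<tau>) (drop i w)"
      and "s = drop (i + length \<tau>) w"
    have wd: "w = (p @ v) @ s"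
      by (simp add: p_def v_def s_def) (metis append_take_drop_id drop_drop add.commute)
    have len: "length p = i" "length s = k" using w by (auto simp: NC_eq p_def s_def)
    have nw: "nc_word w" using w by (simp add: NC_eq)
    then have pv: "nc_word (p @ v)" using wd nc_word_appendD by metis
    have "order_isomorphic v \<tau>" using w by (simp add: v_def)
    then obtain x where x: "nc_word (p @ [x])" "v = inserted a \<rho> b p x"
      using nc_word_order_isomorphic_iff[OF ab \<rho> pv] \<tau> by blast
    have "p @ [x] \<in> NC (i + 1)" using x len by (simp add: NC_eq)
    moreover have "s \<in> extensions k (?g (p @ [x]))"
      using nw wd x len by (simp add: extensions_def)
    moreover have "w = ?g (p @ [x]) @ s" using wd x by simp
    ultimately show "w \<in> ?T" by blast
  next
    fix w assume "w \<in> ?T"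
    then obtain u s where u: "u \<in> NC (i + 1)" and s: "s \<in> extensions k (?g u)"
      and w: "w = ?g u @ s" by blast
    obtain p x where px: "u = p @ [x]" "length p = i" "nc_word (p @ [x])" using NC1[OF u] by blast
    define v where "v = inserted a \<rho> b p x"
    have wv: "w = p @ v @ s" using w px by (simp add: v_def)
    have lv: "length v = length \<tau>" by (simp add: v_def leng)
    have "nc_word (p @ v)" using g[OF u] px by (simp add: v_def)
    then have "order_isomorphic v \<tau>"
      using nc_word_order_isomorphic_iff[OF ab \<rho>] \<tau> px v_def by blast
    moreover have "take (length \<tau>) (drop i w) = v" using wv px lv by simp
    moreover have "w \<in> NC (i + length \<tau> + k)"
      using s w g(3)[OF u] by (simp add: NC_eq extensions_def)
    ultimately show "w \<in> ?S" by simp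
  qed
  moreover have "card ?T = (\<Sum>u\<in>NC (i + 1). card ((@) (?g u) ` extensions k (?g u)))"
  proof (rule card_UN_disjoint)
    show "\<forall>u\<in>NC (i + 1). finite ((@) (?g u) ` extensions k (?g u))"
      using g card_extensions by blast
    show "\<forall>u\<in>NC (i + 1). \<forall>u'\<in>NC (i + 1). u \<noteq> u' \<longrightarrow>
        (@) (?g u) ` extensions k (?g u) \<inter> (@) (?g u') ` extensions k (?g u') = {}"
    proof (intro ballI impI equals0I)
      fix u u' w assume u: "u \<in> NC (i + 1)" "u' \<in> NC (i + 1)" "u \<noteq> u'"
        and "w \<in> (@) (?g u) ` extensions k (?g u) \<inter> (@) (?g u') ` extensions k (?g u')"
      then obtain s s' where "?g u @ s = ?g u' @ s'" by blast
      then have e: "?g u = ?g u'" using g(3)[OF u(1)] g(3)[OF u(2)] append_eq_append_conv by metis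
      obtain p x where px: "u = p @ [x]" "length p = i" using NC1[OF u(1)] by blast
      obtain p' x' where px': "u' = p' @ [x']" "length p' = i" using NC1[OF u(2)] by blast
      have "p = p'" "inserted a \<rho> b p x = inserted a \<rho> b p' x'" using e px px' by auto
      \<comment> \<open>As \<open>a \<ge> 1\<close>, the inserted factor begins with
        \<open>x\<close>, so the contracted word can be recovered.\<close>
      then have "hd (inserted a \<rho> b p x) = hd (inserted a \<rho> b p' x')" by simp
      then have "x = x'" using ab by (cases a) (auto simp: inserted_def)
      then show False using \<open>p = p'\<close> px px' u by simp
    qed
  qed (rule finite_NC)
  moreover have "\<dots> = (\<Sum>u\<in>NC (i + 1). card (extensions k u))"
  proof (intro sum.cong refl)
    fix u assume u: "u \<in> NC (i + 1)"
    have "card ((@) (?g u) ` extensions k (?g u)) = card (extensions k (?g u))"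
      by (intro card_image) (auto simp: inj_on_def)
    also have "\<dots> = card (extensions k u)"
      using card_extensions g[OF u] u by (simp add: NC_eq)
    finally show "card ((@) (?g u) ` extensions k (?g u)) = card (extensions k u)" .
  qed
  ultimately show ?thesis using NC_add[of "i + 1" k] card_NC by simp
qed

section \<open>Summation over the positions\<close>

theorem corollary7:
  fixes a b m n r :: nat and \<rho> \<tau> :: "nat list"
  assumes "a \<ge> 1" and "b \<ge> 1" and "m \<ge> 1"
    and "\<rho> \<in> NC m"
    and "\<tau> = replicate a 1 @ map (\<lambda>x. x + 1) \<rho> @ replicate b 1"
    and "n \<ge> m + a + b - 1"
    and "r = n + 1 - (m + a + b)"
  shows "(\<Sum>\<pi>\<in>NC n. occurrences \<tau> \<pi>) = (2 * r) choose (r + 1)"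
proof -
  let ?oi = "\<lambda>i w. order_isomorphic (take (length \<tau>) (drop i w)) \<tau>"
  have \<rho>: "nc_word \<rho>" "length \<rho> = m" using assms(4) by (auto simp: NC_eq)
  have len: "length \<tau> = m + a + b" using assms(5) \<rho> by simp
  have occ: "occurrences \<tau> w = (\<Sum>i<r. if ?oi i w then 1 else 0)" if "w \<in> NC n" for w
  proof -
    \<comment> \<open>Positions count from 0, so there are exactly \<open>r\<close> of them; in the
      boundary case \<open>n = m + a + b - 1\<close> there is none.\<close>
    have "{i. i + length \<tau> \<le> length w \<and> ?oi i w} = {i \<in> {..<r}. ?oi i w}"
      using that assms(6,7) len by (auto simp: NC_eq)
    then have "occurrences \<tau> w = card {i \<in> {..<r}. ?oi i w}" by (simp add: occurrences_def)
    also have "\<dots> = (\<Sum>i | i \<in> {..<r} \<and> ?oi i w. 1)" by simp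
    also have "\<dots> = (\<Sum>i<r. if ?oi i w then 1 else 0)" by (rule sum.inter_filter) simp
    finally show ?thesis .
  qed
  have at: "(\<Sum>w\<in>NC n. if ?oi i w then 1 else 0) = ballot r 1" if "i < r" for i
  proof -
    have "n = i + length \<tau> + (r - 1 - i)" "i + 1 + (r - 1 - i) = r"
      using that assms(6,7) len by auto
    then have "card {w \<in> NC n. ?oi i w} = ballot r 1"
      using card_NC_occurrence_at[OF assms(1,2) \<rho>(1) assms(5), of i "r - 1 - i"] by simp
    moreover have "(\<Sum>w | w \<in> NC n \<and> ?oi i w. (1::nat)) = (\<Sum>w\<in>NC n. if ?oi i w then 1 else 0)"
      by (rule sum.inter_filter) (rule finite_NC)
    ultimately show ?thesis by simp
  qed
  have "(\<Sum>w\<in>NC n. occurrences \<tau> w) = (\<Sum>w\<in>NC n. \<Sum>i<r. if ?oi i w then 1 else 0)"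
    using occ by (intro sum.cong) auto
  also have "\<dots> = (\<Sum>i<r. \<Sum>w\<in>NC n. if ?oi i w then 1 else 0)" by (rule sum.swap)
  also have "\<dots> = (\<Sum>i<r. ballot r 1)" using at by (intro sum.cong) auto
  also have "\<dots> = r * ballot r 1" by simp
  finally show ?thesis using ballot_catalan by simp
qed

end
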